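(* Consider the Energy Sharing Game $(N,v_0)$ without admission fees. Then: (a) $v_0(S)\ge 0$ for any $S\subseteq N$; (b) the game is superadditive, i.e. $v_0(S\cup T)\ge v_0(S)+v_0(T)$ for all $S,T\subseteq N$ with $S\cap T=\emptyset$; (c) the game is monotonic, i.e. $v_0(S)\le v_0(T)$ whenever $S\subseteq T\subseteq N$; (d) the game is balanced, i.e. $C(N,v_0)\neq\emptyset$, and the allocation $(0,\dots,0,v_0(N))$ (every user gets $0$ and the aggregator gets $v_0(N)$) belongs to $C(N,v_0)$.
   Context: Energy Sharing Game without admission fees. The player set is $N=U\cup\{a\}$, where $U$ is a finite set of users with $|U|\ge 2$ and $a\notin U$ is the aggregator. Fix an integer $m\ge 1$. Each user $i\in U$ has: a compact set $D_i\subseteq\mathbb{R}^{n_i}\times\mathbb{R}^{2m}_+$, whose points are written $(z_i,y_i)$ with $y_i=[y_i^+,y_i^-]\in\mathbb{R}^m_+\times\mathbb{R}^m_+$, such that $D_i^z=\{z_i\in\mathbb{R}^{n_i}:(z_i,0)\in D_i\}$ is nonempty; and a continuous function $f_i:\mathbb{R}^{n_i+2m}\to\mathbb{R}$. There is also a continuous function $f_a:\mathbb{R}^m\to\mathbb{R}_+$ with $f_a(0)=0$. Put $b_i=\max\{f_i(z_i,0):z_i\in D_i^z\}$ and, for $S\subseteq N$ with $a\in S$ and $|S\cap U|\ge 2$, $$b_S=\max\Big\{\sum_{i\in S\cap U} f_i(z_i,y_i)+f_a\Big(\sum_{i\in S\cap U}y_i^+\Big):\ (z_i,y_i)\in D_i\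 (i\in S\cap U),\ \sum_{i\in S\cap U}y_i^+=\sum_{i\in S\cap U}y_i^-\Big\}.$$ The characteristic function is $v_0(S)=b_S-\sum_{i\in S\cap U}b_i$ if $a\in S$ and $|S\cap U|\ge 2$, and $v_0(S)=0$ for every other $S\subseteq N$ (including $S=\emptyset$). An allocation is a vector $x\in\mathbb{R}^{|N|}$, ordered with the aggregator's component last; $x(S)=\sum_{i\in S}x_i$. The core is $C(N,v)=\{x\in\mathbb{R}^{|N|}:x(N)=v(N),\ x(S)\ge v(S)\ \forall S\subset N,\ S\ne\emptyset,\ S\neq N\}$. *)

theory Defs
  imports "HOL-Analysis.Analysis"
begin

text \<open>
  A point \<open>(z, yp, ym)\<close> collects the decision \<open>z\<close> of a user and the two halves of
  \<open>y = [yp, ym]\<close>. The number \<open>m \<ge> 1\<close> is \<open>CARD('m)\<close>. The dimension of \<open>z\<close> differs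
  from user to user, so \<open>z\<close> is a sequence and \<open>\<real>\<^sup>n\<close> is the carrier of
  \<open>Euclidean_space n\<close>, the sequences vanishing from index \<open>n\<close> on.
\<close>

type_synonym 'm point = "(nat \<Rightarrow> real) \<times> (real ^ 'm) \<times> (real ^ 'm)"

definition point_space :: "nat \<Rightarrow> 'm::finite point topology" where
  "point_space n = prod_topology (Euclidean_space n) euclidean"

definition yplus :: "'m::finite point \<Rightarrow> real ^ 'm" where
  "yplus p = fst (snd p)"

definition yminus :: "'m::finite point \<Rightarrow> real ^ 'm" where
  "yminus p = snd (snd p)"

definition Dz :: "'m::finite point set \<Rightarrow> (nat \<Rightarrow> real) set" where
  "Dz D = {z. (z, 0, 0) \<in> D}"

text \<open>
  \<open>GREATEST\<close> denotes the greatest element of the value set, i.e. the maximum, and not merely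
  the supremum.
\<close>

definition user_value :: "'m::finite point set \<Rightarrow> ('m point \<Rightarrow> real) \<Rightarrow> real" where
  "user_value D f = (GREATEST r. \<exists>z\<in>Dz D. r = f (z, 0, 0))"

definition feasible :: "('p \<Rightarrow> 'm::finite point set) \<Rightarrow> 'p set \<Rightarrow> ('p \<Rightarrow> 'm point) \<Rightarrow> bool" where
  "feasible D A w \<longleftrightarrow>
     (\<forall>i\<in>A. w i \<in> D i) \<and> (\<Sum>i\<in>A. yplus (w i)) = (\<Sum>i\<in>A. yminus (w i))"

definition coalition_value ::
  "('p \<Rightarrow> 'm::finite point set) \<Rightarrow> ('p \<Rightarrow> 'm point \<Rightarrow> real) \<Rightarrow> (real ^ 'm \<Rightarrow> real) \<Rightarrow> 'p set \<Rightarrow> real"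
where
  "coalition_value D f fa A =
     (GREATEST r. \<exists>w. feasible D A w \<and>
        r = (\<Sum>i\<in>A. f i (w i)) + fa (\<Sum>i\<in>A. yplus (w i)))"

definition v0 ::
  "'p set \<Rightarrow> 'p \<Rightarrow> ('p \<Rightarrow> 'm::finite point set) \<Rightarrow> ('p \<Rightarrow> 'm point \<Rightarrow> real) \<Rightarrow> (real ^ 'm \<Rightarrow> real)
    \<Rightarrow> 'p set \<Rightarrow> real"
where
  "v0 U a D f fa S =
     (if a \<in> S \<and> card (S \<inter> U) \<ge> 2
      then coalition_value D f fa (S \<inter> U) - (\<Sum>i\<in>S \<inter> U. user_value (D i) (f i))
      else 0)"

text \<open>An allocation in \<open>\<real>\<^sup>N\<close> is a function fixed to \<open>undefined\<close> outside \<open>N\<close>.\<close>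

definition core :: "'p set \<Rightarrow> ('p set \<Rightarrow> real) \<Rightarrow> ('p \<Rightarrow> real) set" where
  "core N v = {x \<in> extensional N. sum x N = v N \<and>
     (\<forall>S. S \<subseteq> N \<and> S \<noteq> {} \<and> S \<noteq> N \<longrightarrow> sum x S \<ge> v S)}"

end

(* The surplus of a set A of users is the coalition value of A minus the sum of the stand-alone
   values. Users joining A can keep their stand-alone optimum with y = 0, so the surplus is
   monotone; it is 0 for A = {}, where the only value is fa 0. All four parts follow, because two
   disjoint coalitions cannot both contain the aggregator. Compactness is needed only for the
   maxima to exist. *)
theory Submission
  imports Defs
begin

text \<open>\<open>GREATEST\<close> is informative only when a greatest element exists; on a compact
  set the extreme value theorem provides one. This turns both \<open>GREATEST\<close> definitions
  into attained maxima.\<close>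

lemma Greatest_image_compact:
  fixes g :: "'a::topological_space \<Rightarrow> real"
  assumes "compact K" and "K \<noteq> {}" and "continuous_on K g"
  shows "\<exists>x\<in>K. (GREATEST r. \<exists>x\<in>K. r = g x) = g x \<and> (\<forall>y\<in>K. g y \<le> g x)"
proof -
  obtain x where "x \<in> K" "\<forall>y\<in>K. g y \<le> g x"
    using continuous_attains_sup[OF assms] by blast
  moreover from this have "(GREATEST r. \<exists>x\<in>K. r = g x) = g x"
    by (intro Greatest_equality) auto
  ultimately show ?thesis by blast
qed

text \<open>Tychonoff's theorem: pinning the coordinates outside \<open>A\<close> to the compact
  singleton \<open>{undefined}\<close> makes \<open>PiE A D\<close> a full product of compact
  sets.\<close>

lemma compact_PiE:
  fixes D :: "'i \<Rightarrow> 'a::topological_space set"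
  assumes "\<And>i. i \<in> A \<Longrightarrow> compact (D i)"
  shows "compact (PiE A D)"
proof -
  have "PiE A D = PiE UNIV (\<lambda>i. if i \<in> A then D i else {undefined})"
    by (auto simp: PiE_def Pi_def extensional_def split: if_splits)
  moreover have "compactin (product_topology (\<lambda>i. euclidean) UNIV)
      (PiE UNIV (\<lambda>i. if i \<in> A then D i else {undefined}))"
    by (subst compactin_PiE) (auto simp: assms)
  ultimately show ?thesis by (simp add: euclidean_product_topology)
qed

text \<open>\<open>Euclidean_space n\<close> carries the subspace topology of the product topology
  on sequences, which is the topology of the type itself. Compactness and continuity can thus be
  handled with \<open>compact\<close> and \<open>continuous_on\<close>.\<close>

lemma point_space_eq_top_of_set:
  "point_space n = (top_of_set (topspace (Euclidean_space n) \<times> UNIV) :: 'm::finite point topology)"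
proof -
  have "Euclidean_space n = top_of_set (topspace (Euclidean_space n))"
    by (simp add: Euclidean_space_def euclidean_product_topology)
  then have "point_space n = prod_topology (top_of_set (topspace (Euclidean_space n)))
      (top_of_set (UNIV :: ((real^'m) \<times> (real^'m)) set))"
    by (simp add: point_space_def)
  then show ?thesis
    by (simp only: prod_topology_subtopology_eu)
qed

lemma compactin_point_space_imp_compact:
  "compactin (point_space n) D \<Longrightarrow> compact D"
  by (simp add: point_space_eq_top_of_set compactin_subtopology)

lemma continuous_map_point_space_imp_continuous_on:
  assumes "compactin (point_space n) D" and "continuous_map (point_space n) euclideanreal f"
  shows "continuous_on D f"
  using assms unfolding point_space_eq_top_of_set compactin_subtopology
  by (auto intro: continuous_on_subset)

lemma user_value_attained:
  assumes "compact D" and "continuous_on D f" and "Dz D \<noteq> {}"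
  shows "\<exists>z\<in>Dz D. user_value D f = f (z, 0, 0)"
proof -
  let ?K = "D \<inter> {p. snd p = (0, 0)}"
  have K: "?K = (\<lambda>z. (z, 0, 0)) ` Dz D"
    by (force simp: Dz_def)
  have "closed {p :: 'a point. snd p = (0, 0)}"
    by (intro closed_Collect_eq continuous_intros)
  then have "compact ?K"
    using assms by (intro compact_Int_closed)
  moreover have "continuous_on ?K f"
    using assms(2) by (rule continuous_on_subset) auto
  ultimately obtain p where "p \<in> ?K" "(GREATEST r. \<exists>x\<in>?K. r = f x) = f p"
    using Greatest_image_compact[of ?K f] assms(3) K by blast
  then show ?thesis
    unfolding user_value_def K by auto
qed

text \<open>Feasibility leaves \<open>w\<close> arbitrary outside \<open>A\<close>, so the feasible
  functions need not form a compact set. Restricting them to \<open>A\<close> changes neither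
  feasibility nor the objective and lands in a compact set, where the maximum is attained.\<close>

lemma coalition_value_attained:
  assumes D: "\<And>i. i \<in> A \<Longrightarrow> compact (D i)"
    and f: "\<And>i. i \<in> A \<Longrightarrow> continuous_on (D i) (f i)"
    and Dz: "\<And>i. i \<in> A \<Longrightarrow> Dz (D i) \<noteq> {}"
    and fa: "continuous_on UNIV fa"
  shows "\<exists>w. feasible D A w \<and>
      coalition_value D f fa A = (\<Sum>i\<in>A. f i (w i)) + fa (\<Sum>i\<in>A. yplus (w i))" (is ?attained)
    and "feasible D A w \<Longrightarrow>
      (\<Sum>i\<in>A. f i (w i)) + fa (\<Sum>i\<in>A. yplus (w i)) \<le> coalition_value D f fa A"
proof -
  define g where "g w = (\<Sum>i\<in>A. f i (w i)) + fa (\<Sum>i\<in>A. yplus (w i))" for w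
  define K where "K = PiE A D \<inter> {w. (\<Sum>i\<in>A. yplus (w i)) = (\<Sum>i\<in>A. yminus (w i))}"
  have K_feasible: "feasible D A w" if "w \<in> K" for w
    using that by (auto simp: K_def feasible_def)
  have K_restrict: "restrict w A \<in> K \<and> g (restrict w A) = g w" if "feasible D A w" for w
    using that by (auto simp: K_def g_def feasible_def)
  have eval: "continuous_on X (\<lambda>w. w i)" for X :: "('a \<Rightarrow> 'b point) set" and i
    by (rule continuous_on_subset[OF continuous_on_product_coordinates]) auto
  have "closed {w :: 'a \<Rightarrow> 'b point. (\<Sum>i\<in>A. yplus (w i)) = (\<Sum>i\<in>A. yminus (w i))}"
    unfolding yplus_def yminus_def by (intro closed_Collect_eq continuous_intros eval)
  then have "compact K"
    unfolding K_def by (intro compact_Int_closed compact_PiE D)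
  moreover have "K \<noteq> {}"
  proof -
    have "\<forall>i\<in>A. \<exists>z. z \<in> Dz (D i)"
      using Dz by blast
    then obtain z where "\<forall>i\<in>A. z i \<in> Dz (D i)"
      by (elim bchoice[THEN exE])
    \<comment> \<open>Without any trade both sides of the balance equation vanish.\<close>
    then have "feasible D A (\<lambda>i. (z i, 0, 0))"
      by (auto simp: feasible_def Dz_def yplus_def yminus_def)
    then show ?thesis using K_restrict by blast
  qed
  moreover have "continuous_on K g"
    unfolding g_def yplus_def
  proof (intro continuous_on_add continuous_on_sum)
    fix i assume "i \<in> A"
    \<comment> \<open>Continuity of \<open>f i\<close> is known on \<open>D i\<close> only; members
      of \<open>K\<close> have their \<open>i\<close>-th coordinate there.\<close>
    then show "continuous_on K (\<lambda>w. f i (w i))"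
      by (intro continuous_on_compose2[OF f eval]) (auto simp: K_def)
  next
    show "continuous_on K (\<lambda>w. fa (\<Sum>i\<in>A. fst (snd (w i))))"
      by (intro continuous_on_compose2[OF fa] continuous_intros eval) auto
  qed
  ultimately obtain w where w: "w \<in> K" "(GREATEST r. \<exists>x\<in>K. r = g x) = g w"
    and max: "\<forall>y\<in>K. g y \<le> g w"
    using Greatest_image_compact by blast
  have "coalition_value D f fa A = (GREATEST r. \<exists>w. feasible D A w \<and> r = g w)"
    by (simp add: coalition_value_def g_def)
  moreover have "(\<lambda>r. \<exists>w. feasible D A w \<and> r = g w) = (\<lambda>r. \<exists>x\<in>K. r = g x)"
    using K_feasible K_restrict by metis
  ultimately have val: "coalition_value D f fa A = g w"
    using w by simp
  then show ?attained
    using K_feasible[OF w(1)] unfolding g_def by blast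
  show "(\<Sum>i\<in>A. f i (w i)) + fa (\<Sum>i\<in>A. yplus (w i)) \<le> coalition_value D f fa A"
    if "feasible D A w" for w
    using K_restrict[OF that] max val unfolding g_def[symmetric] by metis
qed

text \<open>This is the first branch of \<open>v0\<close>, freed from the conditions on
  \<open>a\<close> and on the number of users, so that coalitions can be compared with the empty set
  of users.\<close>

definition surplus ::
  "('p \<Rightarrow> 'm::finite point set) \<Rightarrow> ('p \<Rightarrow> 'm point \<Rightarrow> real) \<Rightarrow> (real ^ 'm \<Rightarrow> real) \<Rightarrow> 'p set \<Rightarrow> real"
where
  "surplus D f fa A = coalition_value D f fa A - (\<Sum>i\<in>A. user_value (D i) (f i))"

lemma surplus_empty:
  assumes "fa 0 = 0"
  shows "surplus D f fa {} = 0"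
  by (simp add: surplus_def coalition_value_def feasible_def assms Greatest_equality)

lemma surplus_mono:
  assumes "finite B" and "A \<subseteq> B"
    and D: "\<And>i. i \<in> B \<Longrightarrow> compact (D i)"
    and f: "\<And>i. i \<in> B \<Longrightarrow> continuous_on (D i) (f i)"
    and Dz: "\<And>i. i \<in> B \<Longrightarrow> Dz (D i) \<noteq> {}"
    and fa: "continuous_on UNIV fa"
  shows "surplus D f fa A \<le> surplus D f fa B"
proof -
  have in_B: "i \<in> B" if "i \<in> A" for i
    using that \<open>A \<subseteq> B\<close> by blast
  have "\<exists>w. feasible D A w \<and>
      coalition_value D f fa A = (\<Sum>i\<in>A. f i (w i)) + fa (\<Sum>i\<in>A. yplus (w i))"
    by (rule coalition_value_attained(1)) (simp_all add: in_B D f Dz fa)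
  then obtain w where w: "feasible D A w"
    and val: "coalition_value D f fa A = (\<Sum>i\<in>A. f i (w i)) + fa (\<Sum>i\<in>A. yplus (w i))"
    by blast
  have "\<forall>i\<in>B. \<exists>z. z \<in> Dz (D i) \<and> user_value (D i) (f i) = f i (z, 0, 0)"
    using user_value_attained[OF D f Dz] unfolding Bex_def by simp
  from bchoice[OF this] obtain z where z: "\<And>i. i \<in> B \<Longrightarrow> z i \<in> Dz (D i)"
      "\<And>i. i \<in> B \<Longrightarrow> user_value (D i) (f i) = f i (z i, 0, 0)"
    by blast
  \<comment> \<open>An optimum of \<open>A\<close> is extended by stand-alone optima: the newcomers
    add exactly their stand-alone values and leave both y-sums, hence the \<open>fa\<close> term,
    unchanged.\<close>
  define u where "u i = (if i \<in> A then w i else (z i, 0, 0))" for i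
  \<comment> \<open>The codomain stays general because both vector sums and real sums are
    split.\<close>
  have split: "sum h B = sum h A + sum h (B - A)" for h :: "'a \<Rightarrow> 'c::comm_monoid_add"
    using sum.subset_diff[OF \<open>A \<subseteq> B\<close> \<open>finite B\<close>, of h] by (simp add: add.commute)
  have y: "(\<Sum>i\<in>B. yplus (u i)) = (\<Sum>i\<in>A. yplus (w i))"
      "(\<Sum>i\<in>B. yminus (u i)) = (\<Sum>i\<in>A. yminus (w i))"
    by (simp_all add: split u_def yplus_def yminus_def)
  have "feasible D B u"
    using w z(1) y by (auto simp: feasible_def u_def Dz_def)
  then have "(\<Sum>i\<in>B. f i (u i)) + fa (\<Sum>i\<in>B. yplus (u i)) \<le> coalition_value D f fa B"
    by (intro coalition_value_attained(2)) (simp_all add: D f Dz fa)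
  moreover have "(\<Sum>i\<in>B. f i (u i)) = (\<Sum>i\<in>A. f i (w i)) + (\<Sum>i\<in>B - A. user_value (D i) (f i))"
    by (simp add: split u_def z(2))
  ultimately show ?thesis
    by (simp add: surplus_def val y(1) split[of "\<lambda>i. user_value (D i) (f i)"])
qed

theorem theorem1:
  fixes U :: "'p set" and a :: 'p and n :: "'p \<Rightarrow> nat"
    and D :: "'p \<Rightarrow> 'm::finite point set"
    and f :: "'p \<Rightarrow> 'm point \<Rightarrow> real"
    and fa :: "real ^ 'm \<Rightarrow> real"
    and N :: "'p set" and v :: "'p set \<Rightarrow> real"
  assumes "finite U" and "card U \<ge> 2" and "a \<notin> U"
    and "\<And>i. i \<in> U \<Longrightarrow> D i \<subseteq> topspace (Euclidean_space (n i)) \<times> {0..} \<times> {0..}"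
    and "\<And>i. i \<in> U \<Longrightarrow> compactin (point_space (n i)) (D i)"
    and "\<And>i. i \<in> U \<Longrightarrow> Dz (D i) \<noteq> {}"
    and "\<And>i. i \<in> U \<Longrightarrow> continuous_map (point_space (n i)) euclideanreal (f i)"
    and "continuous_on UNIV fa" and "\<And>y. fa y \<ge> 0" and "fa 0 = 0"
  defines "N \<equiv> U \<union> {a}" and "v \<equiv> v0 U a D f fa"
  shows "(\<forall>S. S \<subseteq> N \<longrightarrow> v S \<ge> 0) \<and>
    (\<forall>S T. S \<subseteq> N \<and> T \<subseteq> N \<and> S \<inter> T = {} \<longrightarrow> v (S \<union> T) \<ge> v S + v T) \<and>
    (\<forall>S T. S \<subseteq> T \<and> T \<subseteq> N \<longrightarrow> v S \<le> v T) \<and>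
    core N v \<noteq> {} \<and>
    (\<lambda>i\<in>N. if i = a then v N else 0) \<in> core N v"
proof -
  have mono: "surplus D f fa A \<le> surplus D f fa B" if "A \<subseteq> B" "B \<subseteq> U" for A B
  proof (rule surplus_mono)
    show "finite B" using that assms(1) finite_subset by blast
    fix i assume "i \<in> B"
    then have "i \<in> U" using that by blast
    then show "compact (D i)" "continuous_on (D i) (f i)" "Dz (D i) \<noteq> {}"
      using assms(5-7) compactin_point_space_imp_compact
        continuous_map_point_space_imp_continuous_on by blast+
  qed (use that assms(8) in auto)
  have nonneg: "0 \<le> surplus D f fa A" if "A \<subseteq> U" for A
    using mono[OF _ that, of "{}"] surplus_empty[of fa D f] \<open>fa 0 = 0\<close> by simp
  have v_eq: "v S = (if a \<in> S \<and> card (S \<inter> U) \<ge> 2 then surplus D f fa (S \<inter> U) else 0)" for S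
    by (simp add: v_def v0_def surplus_def)
  have v_nonneg: "0 \<le> v S" for S
    by (simp add: v_eq nonneg)
  \<comment> \<open>No bound by \<open>N\<close> is imposed, since \<open>v\<close> sees only
    \<open>S \<inter> U\<close> and whether \<open>a\<close> belongs to \<open>S\<close>. Both
    conditions of the first branch pass from \<open>S\<close> to \<open>T\<close>.\<close>
  have v_mono: "v S \<le> v T" if "S \<subseteq> T" for S T
  proof (cases "a \<in> S \<and> card (S \<inter> U) \<ge> 2")
    case True
    have "card (S \<inter> U) \<le> card (T \<inter> U)"
      using that assms(1) by (intro card_mono) auto
    moreover have "surplus D f fa (S \<inter> U) \<le> surplus D f fa (T \<inter> U)"
      using that by (intro mono) auto
    ultimately show ?thesis
      using True that by (auto simp: v_eq)
  next
    case False
    then have "v S = 0" by (auto simp: v_eq)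
    then show ?thesis using v_nonneg by simp
  qed
  have super: "v S + v T \<le> v (S \<union> T)" if "S \<inter> T = {}" for S T
  proof -
    \<comment> \<open>At most one of two disjoint sets contains \<open>a\<close>; superadditivity
      then reduces to monotonicity.\<close>
    have "v S = 0 \<or> v T = 0"
      using that by (auto simp: v_eq)
    then show ?thesis
      using v_mono[of S "S \<union> T"] v_mono[of T "S \<union> T"] by auto
  qed
  let ?x = "\<lambda>i\<in>N. if i = a then v N else 0"
  have sum_x: "sum ?x S = (if a \<in> S then v N else 0)" if "S \<subseteq> N" for S
  proof -
    have "finite S"
      using that assms(1) unfolding N_def by (auto intro: finite_subset)
    moreover have "sum ?x S = (\<Sum>i\<in>S. if i = a then v N else 0)"
      using that by (intro sum.cong) auto
    ultimately show ?thesis by simp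
  qed
  \<comment> \<open>With \<open>a\<close> in \<open>S\<close> this is monotonicity towards
    \<open>N\<close>; without \<open>a\<close> both sides are 0.\<close>
  have "v S \<le> sum ?x S" if "S \<subseteq> N" for S
    using sum_x[OF that] v_mono[OF that] by (auto simp: v_eq)
  moreover have "sum ?x N = v N"
    using sum_x[of N] by (simp add: N_def)
  ultimately have "?x \<in> core N v"
    by (simp add: core_def)
  then show ?thesis
    using v_nonneg v_mono super by blast
qed

end
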